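(* Let $\mathcal{M}=\{p_\theta:\theta\in\Theta\}$, $\Theta\subset\mathbb{R}^m$, be an $m$-dimensional regular statistical model with Fisher metric matrix $[g_{ij}(\theta)]$, and let $p_{\theta_0},p_{\theta_1}$ be two densities of $\mathcal{M}$ with $\theta_0=(\theta_0^1,\ldots,\theta_0^m)$ and $\theta_1=(\theta_1^1,\ldots,\theta_1^m)$. Consider the hypercube graph $\mathcal{H}(\theta_0,\theta_1)$ whose $2^m$ vertices are, for $a=(a_1,\ldots,a_m)\in\{0,1\}^m$, $$\theta_a=(\theta_{a_1}^1,\ldots,\theta_{a_m}^m),$$ where two vertices $\theta_a,\theta_{a'}$ are joined by an edge if and only if $a$ and $a'$ differ in exactly one index $i$. Give such an edge the non-negative weight equal to the Fisher-Rao distance between $p_{\theta_a}$ and $p_{\theta_{a'}}$ in the uniparametric submodel of $\mathcal{M}$ in which only the $i$-th parameter is allowed to vary, the other coordinates being fixed to their common values $\theta_{a_j}^j$, $j\neq i$; that is, the weight $$\left|\int_{\theta_0^i}^{\theta_1^i}\sqrt{g_{ii}(\theta^1_{a_1},\ldots,\theta^{i-1}_{a_{i-1}},u,\theta^{i+1}_{a_{i+1}},\ldots,\theta^m_{a_m})}\,du\right|.$$ Let $\mathrm{ShortestPath}_{\mathcal{H}(\theta_0,\theta_1)}(\theta_0,\theta_1)$ be the minimum total weight of a path in this edge-weighted graph from the vertex $\theta_{(0,\ldots,0)}=\theta_0$ to the vertex $\theta_{(1,\ldots,1)}=\theta_1$. Then the Fisher-Rao distance in $\mathcal{M}$ satisfies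 $$\rho(\theta_0,\theta_1)\leq\mathrm{ShortestPath}_{\mathcal{H}(\theta_0,\theta_1)}(\theta_0,\theta_1).$$
   Context: A statistical model is a family of probability densities $p_\theta$ with respect to a fixed positive measure, indexed by $\theta$ in an open set $\Theta\subset\mathbb{R}^m$; it is assumed regular, so that the Fisher information matrix $I(\theta)=[g_{ij}(\theta)]$, $g_{ij}(\theta)=E_{p_\theta}[\partial_i\log p_\theta\,\partial_j\log p_\theta]$, is well defined, positive-definite and smooth in $\theta$. The Fisher-Rao distance $\rho$ is the Riemannian distance of the metric $I(\theta)$ on $\Theta$: the infimum of $\int_0^1\sqrt{\dot c(t)^\top I(c(t))\,\dot c(t)}\,dt$ over piecewise smooth curves $c:[0,1]\to\Theta$ joining the two parameters. The upper bound is called the Fisher-Manhattan upper bound. *)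

theory Defs
  imports
    "HOL-Analysis.Analysis"
    "HOL-Probability.Probability"
    "Graph_Theory.Pair_Digraph"
    "Graph_Theory.Shortest_Path"
begin

section \<open>Smoothness on open subsets of Euclidean space\<close>

definition has_partial :: "'m \<Rightarrow> (real ^ 'm \<Rightarrow> real) \<Rightarrow> real ^ 'm::finite \<Rightarrow> bool" where
  "has_partial i f \<theta> \<longleftrightarrow> (\<lambda>h::real. f (\<theta> + h *\<^sub>R axis i 1)) field_differentiable (at 0)"

definition partial :: "'m \<Rightarrow> (real ^ 'm \<Rightarrow> real) \<Rightarrow> real ^ 'm::finite \<Rightarrow> real" where
  "partial i f \<theta> = deriv (\<lambda>h::real. f (\<theta> + h *\<^sub>R axis i 1)) 0"

text \<open>Only meaningful for open \<open>S\<close>, where it is the usual class \<open>C\<^sup>k\<close>: all iterated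
  partial derivatives up to order \<open>k\<close> exist and are continuous.\<close>

primrec Ck_on :: "nat \<Rightarrow> (real ^ 'm::finite) set \<Rightarrow> (real ^ 'm \<Rightarrow> real) \<Rightarrow> bool" where
  "Ck_on 0 S f \<longleftrightarrow> continuous_on S f"
| "Ck_on (Suc k) S f \<longleftrightarrow>
     continuous_on S f \<and> (\<forall>i. (\<forall>\<theta>\<in>S. has_partial i f \<theta>) \<and> Ck_on k S (partial i f))"

definition smooth_on_open :: "(real ^ 'm::finite) set \<Rightarrow> (real ^ 'm \<Rightarrow> real) \<Rightarrow> bool" where
  "smooth_on_open S f \<longleftrightarrow> (\<forall>k. Ck_on k S f)"


section \<open>Statistical models and the Fisher metric\<close>

text \<open>A model is given by the base measure \<open>M\<close>, the parameter set \<open>\<Theta>\<close> and the family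
  \<open>p\<close> of densities with respect to \<open>M\<close>.\<close>

definition model_measure ::
    "'x measure \<Rightarrow> (real ^ 'm::finite \<Rightarrow> 'x \<Rightarrow> real) \<Rightarrow> real ^ 'm \<Rightarrow> 'x measure" where
  "model_measure M p \<theta> = density M (\<lambda>x. ennreal (p \<theta> x))"

definition score ::
    "(real ^ 'm::finite \<Rightarrow> 'x \<Rightarrow> real) \<Rightarrow> 'm \<Rightarrow> real ^ 'm \<Rightarrow> 'x \<Rightarrow> real" where
  "score p i \<theta> x = partial i (\<lambda>\<theta>'. ln (p \<theta>' x)) \<theta>"

definition fisher_matrix ::
    "'x measure \<Rightarrow> (real ^ 'm::finite \<Rightarrow> 'x \<Rightarrow> real) \<Rightarrow> real ^ 'm \<Rightarrow> real ^ 'm ^ 'm" where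
  "fisher_matrix M p \<theta> =
     (\<chi> i j. \<integral>x. score p i \<theta> x * score p j \<theta> x \<partial>model_measure M p \<theta>)"

text \<open>The differentiability clause is stated for the densities: they are positive almost
  everywhere for their own measure, so there \<open>ln (p \<theta> x)\<close> is differentiable as well and
  \<^const>\<open>score\<close> is a genuine derivative.\<close>

definition regular_model ::
    "'x measure \<Rightarrow> (real ^ 'm::finite) set \<Rightarrow> (real ^ 'm \<Rightarrow> 'x \<Rightarrow> real) \<Rightarrow> bool" where
  "regular_model M \<Theta> p \<longleftrightarrow>
     open \<Theta> \<and>
     (\<forall>\<theta>\<in>\<Theta>.
        p \<theta> \<in> borel_measurable M \<and>
        (\<forall>x\<in>space M. 0 \<le> p \<theta> x) \<and>
        prob_space (model_measure M p \<theta>) \<and>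
        (\<forall>i. AE x in model_measure M p \<theta>. has_partial i (\<lambda>\<theta>'. p \<theta>' x) \<theta>) \<and>
        (\<forall>i j. integrable (model_measure M p \<theta>) (\<lambda>x. score p i \<theta> x * score p j \<theta> x)) \<and>
        (\<forall>v. v \<noteq> 0 \<longrightarrow> v \<bullet> (fisher_matrix M p \<theta> *v v) > 0)) \<and>
     (\<forall>i j. smooth_on_open \<Theta> (\<lambda>\<theta>. fisher_matrix M p \<theta> $ i $ j))"


section \<open>The Fisher-Rao distance\<close>

text \<open>\<open>c\<close> is \<open>C\<^sup>\<infinity>\<close> on \<open>[a, b]\<close>, with one-sided derivatives at the endpoints;
  \<open>D k\<close> is the \<open>k\<close>-th derivative.\<close>

definition smooth_on_interval :: "real \<Rightarrow> real \<Rightarrow> (real \<Rightarrow> 'v::real_normed_vector) \<Rightarrow> bool" where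
  "smooth_on_interval a b c \<longleftrightarrow>
     (\<exists>D::nat \<Rightarrow> real \<Rightarrow> 'v.
        (\<forall>t\<in>{a..b}. D 0 t = c t) \<and>
        (\<forall>k. \<forall>t\<in>{a..b}. (D k has_vector_derivative D (Suc k) t) (at t within {a..b})))"

text \<open>Smoothness is required up to the endpoints of every closed piece, which is what makes the
  length integral below converge (for \<^const>\<open>valid_path\<close> the derivative may be unbounded
  near a break point). Continuity on \<open>[0, 1]\<close> follows since adjacent pieces share an
  endpoint.\<close>

definition piecewise_smooth_curve :: "(real \<Rightarrow> 'v::real_normed_vector) \<Rightarrow> bool" where
  "piecewise_smooth_curve c \<longleftrightarrow>
     (\<exists>(n::nat) (\<tau>::nat \<Rightarrow> real).
        \<tau> 0 = 0 \<and> \<tau> n = 1 \<and>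
        (\<forall>k<n. \<tau> k < \<tau> (Suc k) \<and> smooth_on_interval (\<tau> k) (\<tau> (Suc k)) c))"

text \<open>At the finitely many break points the derivative may not exist; this does not affect the
  integral.\<close>

definition fisher_length ::
    "'x measure \<Rightarrow> (real ^ 'm::finite \<Rightarrow> 'x \<Rightarrow> real) \<Rightarrow> (real \<Rightarrow> real ^ 'm) \<Rightarrow> real" where
  "fisher_length M p c =
     integral {0..1} (\<lambda>t. let c' = vector_derivative c (at t within {0..1})
                          in sqrt (c' \<bullet> (fisher_matrix M p (c t) *v c')))"

text \<open>Extended-real valued: the distance is \<open>\<infinity>\<close> if no curve in \<open>\<Theta>\<close> joins the two
  parameters.\<close>

definition fisher_rao_dist ::
    "'x measure \<Rightarrow> (real ^ 'm::finite) set \<Rightarrow> (real ^ 'm \<Rightarrow> 'x \<Rightarrow> real) \<Rightarrow>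
     real ^ 'm \<Rightarrow> real ^ 'm \<Rightarrow> ereal" where
  "fisher_rao_dist M \<Theta> p \<theta>\<^sub>0 \<theta>\<^sub>1 =
     (INF c \<in> {c. piecewise_smooth_curve c \<and> c ` {0..1} \<subseteq> \<Theta> \<and> c 0 = \<theta>\<^sub>0 \<and> c 1 = \<theta>\<^sub>1}.
        ereal (fisher_length M p c))"


section \<open>Uniparametric submodels\<close>

definition subst_coord :: "real ^ 'm::finite \<Rightarrow> 'm \<Rightarrow> real \<Rightarrow> real ^ 'm" where
  "subst_coord \<theta> i u = (\<chi> j. if j = i then u else \<theta> $ j)"

text \<open>The submodel in which only the \<open>i\<close>-th parameter varies, the other coordinates being those
  of \<open>\<theta>\<close>; it is a model with parameters in \<open>\<real>\<^sup>1\<close>.\<close>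

definition submodel_params :: "(real ^ 'm::finite) set \<Rightarrow> real ^ 'm \<Rightarrow> 'm \<Rightarrow> (real ^ 1) set" where
  "submodel_params \<Theta> \<theta> i = {v. subst_coord \<theta> i (v $ 1) \<in> \<Theta>}"

definition submodel ::
    "(real ^ 'm::finite \<Rightarrow> 'x \<Rightarrow> real) \<Rightarrow> real ^ 'm \<Rightarrow> 'm \<Rightarrow> real ^ 1 \<Rightarrow> 'x \<Rightarrow> real" where
  "submodel p \<theta> i v = p (subst_coord \<theta> i (v $ 1))"


section \<open>The weighted hypercube graph\<close>

text \<open>Vertices are labelled by \<open>a \<in> {0,1}\<^sup>m\<close>, with \<^const>\<open>True\<close> for 1. An
  undirected edge is represented by its two opposite arcs.\<close>

definition hypercube :: "('m::finite \<Rightarrow> bool) pair_pre_digraph" where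
  "hypercube = \<lparr> pverts = UNIV, parcs = {(a, b). \<exists>!i. a i \<noteq> b i} \<rparr>"

lemma pair_graph_hypercube: "pair_graph (hypercube :: ('m::finite \<Rightarrow> bool) pair_pre_digraph)"
proof
  show "symmetric (with_proj (hypercube :: ('m \<Rightarrow> bool) pair_pre_digraph))"
    by (auto simp: symmetric_def sym_def hypercube_def eq_commute)
qed (auto simp: hypercube_def)

definition cube_vertex :: "real ^ 'm::finite \<Rightarrow> real ^ 'm \<Rightarrow> ('m \<Rightarrow> bool) \<Rightarrow> real ^ 'm" where
  "cube_vertex \<theta>\<^sub>0 \<theta>\<^sub>1 a = (\<chi> i. if a i then \<theta>\<^sub>1 $ i else \<theta>\<^sub>0 $ i)"

definition edge_index :: "('m \<Rightarrow> bool) \<times> ('m \<Rightarrow> bool) \<Rightarrow> 'm" where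
  "edge_index e = (THE i. fst e i \<noteq> snd e i)"

definition edge_weight ::
    "'x measure \<Rightarrow> (real ^ 'm::finite \<Rightarrow> 'x \<Rightarrow> real) \<Rightarrow> real ^ 'm \<Rightarrow> real ^ 'm \<Rightarrow>
     ('m \<Rightarrow> bool) \<times> ('m \<Rightarrow> bool) \<Rightarrow> real" where
  "edge_weight M p \<theta>\<^sub>0 \<theta>\<^sub>1 e =
     (let i = edge_index e in
      \<bar>LBINT u=\<theta>\<^sub>0 $ i..\<theta>\<^sub>1 $ i.
         sqrt (fisher_matrix M p (subst_coord (cube_vertex \<theta>\<^sub>0 \<theta>\<^sub>1 (fst e)) i u) $ i $ i)\<bar>)"

text \<open>The library's \<open>\<mu>\<close> is the infimum of the costs of all walks. The graph is finite and the
  weights are non-negative, so this is the minimum over all paths.\<close>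

definition shortest_path ::
    "'x measure \<Rightarrow> (real ^ 'm::finite \<Rightarrow> 'x \<Rightarrow> real) \<Rightarrow> real ^ 'm \<Rightarrow> real ^ 'm \<Rightarrow> ereal" where
  "shortest_path M p \<theta>\<^sub>0 \<theta>\<^sub>1 =
     wf_digraph.\<mu> (with_proj hypercube) (edge_weight M p \<theta>\<^sub>0 \<theta>\<^sub>1) (\<lambda>_. False) (\<lambda>_. True)"

end

theory Submission
  imports Defs
begin

text \<open>A walk in the hypercube traces a curve made of coordinate segments, and the length of such a
  segment is the integral of \<open>\<surd>g\<^sub>i\<^sub>i\<close>, that is, the weight of the edge; concatenating the segments
  of a walk gives an admissible curve whose length is the cost of the walk.
  In a one-parameter model the length of a curve \<open>c\<close> is \<open>\<integral>|c'| \<surd>g(c)\<close>. This is at least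
  \<open>|\<integral>c' \<surd>g(c)|\<close>, which by substitution depends only on the endpoints of \<open>c\<close>, and the
  segment attains the bound.\<close>

section \<open>Piecewise smooth curves\<close>

text \<open>Of the whole tower of derivatives only the first is extracted. It is continuous up to
  the ends of the piece, but the two-sided derivative of \<open>c\<close> is claimed only inside,
  since \<open>c\<close> may have a kink where the next piece begins.\<close>

lemma smooth_on_interval_derivative:
  assumes "smooth_on_interval a b c"
  obtains D where "continuous_on {a..b} c" "continuous_on {a..b} D"
    "\<And>t. t \<in> {a<..<b} \<Longrightarrow> (c has_vector_derivative D t) (at t)"
proof -
  from assms obtain D where D0: "\<And>t. t \<in> {a..b} \<Longrightarrow> D 0 t = c t"
    and D: "\<And>k t. t \<in> {a..b} \<Longrightarrow> (D k has_vector_derivative D (Suc k) t) (at t within {a..b})"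
    unfolding smooth_on_interval_def by blast
  have cont: "continuous_on {a..b} (D k)" for k
    using D by (intro continuous_on_vector_derivative) auto
  have "continuous_on {a..b} c"
    using cont[of 0] by (rule continuous_on_eq) (use D0 in auto)
  moreover have "(c has_vector_derivative D 1 t) (at t)" if t: "t \<in> {a<..<b}" for t
  proof -
    have "(D 0 has_vector_derivative D 1 t) (at t)"
      using D[of t 0] t at_within_Icc_at[of a t b] by simp
    then show ?thesis
      by (rule has_vector_derivative_transform_within_open[OF _ open_greaterThanLessThan t])
        (use D0 in auto)
  qed
  ultimately show ?thesis using cont[of 1] that by blast
qed

text \<open>By the chain rule the \<open>k\<close>-th derivative picks up the factor
  \<open>r ^ k\<close>. Since \<open>g\<close> has to agree with the rescaled \<open>c\<close> on
  one closed interval only, this applies to either half of a joined path.\<close>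

lemma smooth_on_interval_affine:
  assumes c: "smooth_on_interval a b c" and r: "r > 0"
    and eq: "\<And>t. t \<in> {(a - s) / r..(b - s) / r} \<Longrightarrow> g t = c (r * t + s)"
  shows "smooth_on_interval ((a - s) / r) ((b - s) / r) g"
proof -
  let ?I = "{(a - s) / r..(b - s) / r}"
  from c obtain D where D0: "\<And>t. t \<in> {a..b} \<Longrightarrow> D 0 t = c t"
    and D: "\<And>k t. t \<in> {a..b} \<Longrightarrow> (D k has_vector_derivative D (Suc k) t) (at t within {a..b})"
    unfolding smooth_on_interval_def by blast
  have mem: "r * t + s \<in> {a..b}" if "t \<in> ?I" for t
    using that r by (auto simp: field_simps)
  let ?E = "\<lambda>k t. r ^ k *\<^sub>R D k (r * t + s)"
  have "(?E k has_vector_derivative ?E (Suc k) t) (at t within ?I)" if t: "t \<in> ?I" for k t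
  proof -
    have "((\<lambda>t. r * t + s) has_vector_derivative r) (at t within ?I)"
      by (auto intro!: derivative_eq_intros simp: has_real_derivative_iff_has_vector_derivative[symmetric])
    moreover have "(D k has_vector_derivative D (Suc k) (r * t + s))
        (at (r * t + s) within (\<lambda>t. r * t + s) ` ?I)"
      using D[OF mem[OF t]] by (rule has_vector_derivative_within_subset) (use mem in auto)
    ultimately have "((D k \<circ> (\<lambda>t. r * t + s)) has_vector_derivative
        r *\<^sub>R D (Suc k) (r * t + s)) (at t within ?I)"
      by (rule vector_diff_chain_within)
    then have "((\<lambda>t. r ^ k *\<^sub>R (D k \<circ> (\<lambda>t. r * t + s)) t) has_vector_derivative
        r ^ k *\<^sub>R (r *\<^sub>R D (Suc k) (r * t + s))) (at t within ?I)"
      by (rule bounded_linear.has_vector_derivative[OF bounded_linear_scaleR_right])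
    then show ?thesis by (simp add: mult.commute o_def)
  qed
  moreover have "?E 0 t = g t" if "t \<in> ?I" for t
    using D0[OF mem[OF that]] eq[OF that] by simp
  ultimately show ?thesis
    unfolding smooth_on_interval_def by (intro exI[of _ ?E]) auto
qed

section \<open>Finite partitions of the parameter interval\<close>

lemma partition_le:
  fixes \<tau> :: "nat \<Rightarrow> real"
  assumes "\<And>k. k < n \<Longrightarrow> \<tau> k < \<tau> (Suc k)"
  shows "\<tau> 0 \<le> \<tau> n"
  using assms by (induction n) (simp, metis less_Suc_eq less_imp_le order_trans)

lemma Icc_partition:
  fixes \<tau> :: "nat \<Rightarrow> real"
  assumes "n > 0" "\<And>k. k < n \<Longrightarrow> \<tau> k < \<tau> (Suc k)"
  shows "{\<tau> 0..\<tau> n} = (\<Union>k<n. {\<tau> k..\<tau> (Suc k)})"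
  using assms
proof (induction n rule: nat_induct_non_zero)
  case 1
  then show ?case by (simp add: lessThan_Suc)
next
  case (Suc n)
  have mono: "\<tau> 0 \<le> \<tau> n"
    by (rule partition_le) (use Suc.prems in auto)
  have "{\<tau> 0..\<tau> (Suc n)} = {\<tau> 0..\<tau> n} \<union> {\<tau> n..\<tau> (Suc n)}"
    using mono Suc.prems[of n] by auto
  also have "{\<tau> 0..\<tau> n} = (\<Union>k<n. {\<tau> k..\<tau> (Suc k)})"
    using Suc by simp
  finally show ?case by (auto simp: lessThan_Suc)
qed

lemma integrable_on_partition:
  fixes \<tau> :: "nat \<Rightarrow> real" and f :: "real \<Rightarrow> 'a::banach"
  assumes "\<And>k. k < n \<Longrightarrow> \<tau> k < \<tau> (Suc k)"
    and "\<And>k. k < n \<Longrightarrow> f integrable_on {\<tau> k..\<tau> (Suc k)}"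
  shows "f integrable_on {\<tau> 0..\<tau> n}"
  using assms
proof (induction n)
  case 0
  show ?case using integrable_on_refl[of f "\<tau> 0"] by simp
next
  case (Suc n)
  have "\<tau> 0 \<le> \<tau> n"
    by (rule partition_le) (use Suc.prems(1) in simp)
  moreover have "f integrable_on {\<tau> 0..\<tau> n}"
    by (rule Suc.IH) (use Suc.prems in simp_all)
  ultimately show ?case
    using Suc.prems(1)[of n] Suc.prems(2)[of n]
    by (simp add: Henstock_Kurzweil_Integration.integrable_combine[where c = "\<tau> n"])
qed

lemma piecewise_smooth_curve_partition:
  assumes "piecewise_smooth_curve c"
  obtains n \<tau> where "n > 0" "\<tau> 0 = 0" "\<tau> n = 1" "\<And>k. k < n \<Longrightarrow> \<tau> k < \<tau> (Suc k)"
    "\<And>k. k < n \<Longrightarrow> smooth_on_interval (\<tau> k) (\<tau> (Suc k)) c"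
    "{0..1} = (\<Union>k<n. {\<tau> k..\<tau> (Suc k)})"
proof -
  from assms obtain n \<tau> where *: "\<tau> 0 = 0" "\<tau> n = 1" "\<And>k. k < n \<Longrightarrow> \<tau> k < \<tau> (Suc k)"
    "\<And>k. k < n \<Longrightarrow> smooth_on_interval (\<tau> k) (\<tau> (Suc k)) c"
    unfolding piecewise_smooth_curve_def by blast
  then have "n > 0" by (cases n) auto
  with * Icc_partition[of n \<tau>] that[of n \<tau>] show ?thesis by simp
qed

text \<open>The exceptional set consists of the break points, and continuity comes from gluing
  finitely many closed pieces. This is the form in which curves enter the integration
  arguments.\<close>

lemma piecewise_smooth_curve_derivative:
  assumes "piecewise_smooth_curve c"
  obtains S where "finite S" "continuous_on {0..1} c"
    "\<And>t. t \<in> {0<..<1} - S \<Longrightarrow> (c has_vector_derivative vector_derivative c (at t)) (at t)"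
proof -
  obtain n \<tau> where n: "n > 0" and \<tau>: "\<tau> 0 = 0" "\<tau> n = 1" "\<And>k. k < n \<Longrightarrow> \<tau> k < \<tau> (Suc k)"
    and sm: "\<And>k. k < n \<Longrightarrow> smooth_on_interval (\<tau> k) (\<tau> (Suc k)) c"
    and un: "{0..1} = (\<Union>k<n. {\<tau> k..\<tau> (Suc k)})"
    by (rule piecewise_smooth_curve_partition[OF assms]) blast
  have "continuous_on (\<Union>k<n. {\<tau> k..\<tau> (Suc k)}) c"
    using sm by (intro continuous_on_closed_Union) (auto elim: smooth_on_interval_derivative)
  moreover have "(c has_vector_derivative vector_derivative c (at t)) (at t)"
    if t: "t \<in> {0<..<1} - \<tau> ` {..n}" for t
  proof -
    have "t \<in> {0..1}"
      using t by auto
    then obtain k where k: "k < n" "t \<in> {\<tau> k..\<tau> (Suc k)}"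
      unfolding un by blast
    moreover have "t \<noteq> \<tau> k" "t \<noteq> \<tau> (Suc k)" using t k by auto
    ultimately have "t \<in> {\<tau> k<..<\<tau> (Suc k)}" by auto
    then show ?thesis
      using sm[OF k(1)]
      by (metis smooth_on_interval_derivative vector_derivative_at)
  qed
  ultimately show ?thesis using that[of "\<tau> ` {..n}"] un by simp
qed

section \<open>Constructing and concatenating piecewise smooth curves\<close>

lemma piecewise_smooth_curve_if_smooth:
  assumes "smooth_on_interval 0 1 c"
  shows "piecewise_smooth_curve c"
  unfolding piecewise_smooth_curve_def
  \<comment> \<open>The embedding \<open>real\<close> serves as the partition: its values at 0 and 1
    bound the single piece.\<close>
  using assms by (intro exI[of _ "Suc 0"] exI[of _ real]) auto

lemma smooth_on_interval_affine_curve: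
  fixes v w :: "'v::real_normed_vector"
  shows "smooth_on_interval a b (\<lambda>t. v + t *\<^sub>R w)"
proof -
  let ?D = "\<lambda>k t. case k of 0 \<Rightarrow> v + t *\<^sub>R w | Suc 0 \<Rightarrow> w | Suc (Suc _) \<Rightarrow> 0"
  have "(?D k has_vector_derivative ?D (Suc k) t) (at t within {a..b})" for k t
    by (auto split: nat.split intro!: derivative_eq_intros)
  then show ?thesis
    unfolding smooth_on_interval_def by (intro exI[of _ ?D]) auto
qed

lemma piecewise_smooth_curve_joinpaths:
  assumes "piecewise_smooth_curve c\<^sub>1" "piecewise_smooth_curve c\<^sub>2" and "c\<^sub>1 1 = c\<^sub>2 0"
  shows "piecewise_smooth_curve (c\<^sub>1 +++ c\<^sub>2)"
proof -
  obtain n \<tau> where \<tau>: "\<tau> 0 = 0" "\<tau> n = 1" "\<And>k. k < n \<Longrightarrow> \<tau> k < \<tau> (Suc k)"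
    and sm1: "\<And>k. k < n \<Longrightarrow> smooth_on_interval (\<tau> k) (\<tau> (Suc k)) c\<^sub>1"
    and un1: "{0..1} = (\<Union>k<n. {\<tau> k..\<tau> (Suc k)})"
    by (rule piecewise_smooth_curve_partition[OF assms(1)]) blast
  obtain m \<sigma> where \<sigma>: "\<sigma> 0 = 0" "\<sigma> m = 1" "\<And>k. k < m \<Longrightarrow> \<sigma> k < \<sigma> (Suc k)"
    and sm2: "\<And>k. k < m \<Longrightarrow> smooth_on_interval (\<sigma> k) (\<sigma> (Suc k)) c\<^sub>2"
    and un2: "{0..1} = (\<Union>k<m. {\<sigma> k..\<sigma> (Suc k)})"
    by (rule piecewise_smooth_curve_partition[OF assms(2)]) blast
  \<comment> \<open>The partition of \<open>c\<^sub>1\<close> is squeezed into [0, 1/2] and that of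
    \<open>c\<^sub>2\<close> into [1/2, 1]. At \<open>k = n\<close> both formulas give 1/2, so the
    second one may be used there as well.\<close>
  define \<rho> where "\<rho> k = (if k \<le> n then \<tau> k / 2 else (\<sigma> (k - n) + 1) / 2)" for k
  have \<rho>2: "\<rho> k = (\<sigma> (k - n) + 1) / 2" if "n \<le> k" for k
    using that \<tau>(2) \<sigma>(1) by (auto simp: \<rho>_def)
  have "\<rho> k < \<rho> (Suc k) \<and> smooth_on_interval (\<rho> k) (\<rho> (Suc k)) (c\<^sub>1 +++ c\<^sub>2)" if "k < n + m" for k
  proof (cases "k < n")
    case True
    then have \<rho>: "\<rho> k = \<tau> k / 2" "\<rho> (Suc k) = \<tau> (Suc k) / 2"
      by (auto simp: \<rho>_def)
    have sub: "{\<tau> k..\<tau> (Suc k)} \<subseteq> {0..1}" using un1 True by auto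
    have "smooth_on_interval ((\<tau> k - 0) / 2) ((\<tau> (Suc k) - 0) / 2) (c\<^sub>1 +++ c\<^sub>2)"
    proof (rule smooth_on_interval_affine[OF sm1[OF True]])
      fix t assume "t \<in> {(\<tau> k - 0) / 2..(\<tau> (Suc k) - 0) / 2}"
      then have "2 * t \<in> {\<tau> k..\<tau> (Suc k)}" by auto
      then show "(c\<^sub>1 +++ c\<^sub>2) t = c\<^sub>1 (2 * t + 0)"
        using sub by (auto simp: joinpaths_def)
    qed simp
    then show ?thesis using \<tau>(3)[OF True] unfolding \<rho> by simp
  next
    case False
    define j where "j = k - n"
    have j: "j < m" "Suc k - n = Suc j" using False that by (auto simp: j_def)
    then have \<rho>: "\<rho> k = (\<sigma> j + 1) / 2" "\<rho> (Suc k) = (\<sigma> (Suc j) + 1) / 2"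
      using \<rho>2[of k] \<rho>2[of "Suc k"] False by (auto simp: j_def)
    have sub: "{\<sigma> j..\<sigma> (Suc j)} \<subseteq> {0..1}" using un2 j by auto
    have "smooth_on_interval ((\<sigma> j - (-1)) / 2) ((\<sigma> (Suc j) - (-1)) / 2) (c\<^sub>1 +++ c\<^sub>2)"
    proof (rule smooth_on_interval_affine[OF sm2[OF j(1)]])
      fix t assume "t \<in> {(\<sigma> j - (-1)) / 2..(\<sigma> (Suc j) - (-1)) / 2}"
      then have "2 * t - 1 \<in> {\<sigma> j..\<sigma> (Suc j)}" by auto
      then have t: "t \<ge> 1 / 2" using sub by auto
      show "(c\<^sub>1 +++ c\<^sub>2) t = c\<^sub>2 (2 * t + (-1))"
        \<comment> \<open>At the midpoint \<open>joinpaths\<close> takes the value of its first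
          curve, so the claim there rests on the two curves meeting.\<close>
        proof (cases "t = 1 / 2")
        case True
        show ?thesis unfolding True using assms(3) by (simp add: joinpaths_def)
      qed (use t in \<open>simp add: joinpaths_def\<close>)
    qed simp
    then show ?thesis using \<sigma>(3)[OF j(1)] unfolding \<rho> by simp
  qed
  moreover have "\<rho> 0 = 0" "\<rho> (n + m) = 1"
    using \<tau> \<sigma> \<rho>2[of "n + m"] by (auto simp: \<rho>_def)
  ultimately show ?thesis
    unfolding piecewise_smooth_curve_def by (intro exI[of _ "n + m"] exI[of _ \<rho>]) auto
qed

text \<open>With \<open>G\<close> an antiderivative of \<open>h\<close>, the composite of
  \<open>G\<close> and \<open>f\<close> is continuous and has the integrand as derivative off a
  finite set, so the fundamental theorem applies. The function \<open>f\<close> may turn back: only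
  its end values survive, and the oriented integral covers \<open>f 1 < f 0\<close>.\<close>

lemma has_integral_substitution_piecewise:
  fixes f f' h :: "real \<Rightarrow> real"
  assumes S: "finite S" and f: "continuous_on {0..1} f"
    and f': "\<And>t. t \<in> {0<..<1} - S \<Longrightarrow> (f has_vector_derivative f' t) (at t)"
    and h: "continuous_on (f ` {0..1}) h"
  shows "((\<lambda>t. f' t * h (f t)) has_integral (LBINT u=f 0..f 1. h u)) {0..1}"
proof -
  \<comment> \<open>The image of \<open>f\<close> can exceed the interval between \<open>f 0\<close>
    and \<open>f 1\<close>, so \<open>G\<close> is based at the left end of the whole image.\<close>
  obtain \<alpha> \<beta> where im: "f ` {0..1} = {\<alpha>..\<beta>}"
    using continuous_image_closed_interval[OF _ f] by auto
  define G where "G u = integral {\<alpha>..u} h" for u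
  have G: "(G has_vector_derivative h u) (at u within {\<alpha>..\<beta>})" if "u \<in> {\<alpha>..\<beta>}" for u
    unfolding G_def using integral_has_vector_derivative[of \<alpha> \<beta> h u] h that im by simp
  then have "continuous_on {\<alpha>..\<beta>} G"
    by (rule continuous_on_vector_derivative)
  then have contG: "continuous_on {0..1} (G \<circ> f)"
    using f im by (intro continuous_on_compose) auto
  have deriv: "((G \<circ> f) has_vector_derivative f' t * h (f t)) (at t)"
    if t: "t \<in> {0<..<1} - S" for t
  proof -
    \<comment> \<open>The chain rule is used within [0, 1] because \<open>f t\<close> may be an end
      of the image, where \<open>G\<close> is known to have only a one-sided derivative. As
      \<open>t\<close> is interior, the result is two-sided.\<close>
    have "(f has_vector_derivative f' t) (at t within {0..1})"
      using f'[OF t] by (rule has_vector_derivative_at_within)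
    moreover have "(G has_vector_derivative h (f t)) (at (f t) within f ` {0..1})"
      unfolding im by (rule G) (use t im in force)
    ultimately have "((G \<circ> f) has_vector_derivative f' t *\<^sub>R h (f t)) (at t within {0..1})"
      by (rule vector_diff_chain_within)
    then show ?thesis using t by (simp add: at_within_Icc_at)
  qed
  have "((\<lambda>t. f' t * h (f t)) has_integral ((G \<circ> f) 1 - (G \<circ> f) 0)) {0..1}"
    by (rule fundamental_theorem_of_calculus_interior_strong[OF S _ deriv contG]) auto
  moreover have "(LBINT u=f 0..f 1. h u) = G (f 1) - G (f 0)"
  proof (rule interval_integral_FTC_finite)
    have "f 0 \<in> f ` {0..1}" "f 1 \<in> f ` {0..1}" by auto
    then have sub: "{min (f 0) (f 1)..max (f 0) (f 1)} \<subseteq> {\<alpha>..\<beta>}"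
      unfolding im by auto
    then show "continuous_on {min (f 0) (f 1)..max (f 0) (f 1)} h"
      using h im continuous_on_subset by metis
    show "(G has_vector_derivative h u) (at u within {min (f 0) (f 1)..max (f 0) (f 1)})"
      if "min (f 0) (f 1) \<le> u" "u \<le> max (f 0) (f 1)" for u
      using sub that by (intro has_vector_derivative_within_subset[OF G]) auto
  qed
  ultimately show ?thesis by simp
qed


section \<open>Fisher length\<close>

text \<open>The integrand of \<open>fisher_length\<close> with the two-sided derivative, so that it
  does not refer to the interval when a curve is cut or rescaled. The two integrands can differ only
  at 0 and 1.\<close>

definition fisher_speed ::
    "'x measure \<Rightarrow> (real ^ 'm::finite \<Rightarrow> 'x \<Rightarrow> real) \<Rightarrow> (real \<Rightarrow> real ^ 'm) \<Rightarrow> real \<Rightarrow> real" where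
  "fisher_speed M p c t =
     (let c' = vector_derivative c (at t) in sqrt (c' \<bullet> (fisher_matrix M p (c t) *v c')))"

lemma fisher_length_speed: "fisher_length M p c = integral {0..1} (fisher_speed M p c)"
  unfolding fisher_length_def
proof (rule integral_spike)
  show "negligible {0, 1::real}" by (simp add: negligible_finite)
  fix t :: real assume "t \<in> {0..1} - {0, 1}"
  then have "at t within {0..1} = at t"
    by (intro at_within_Icc_at) auto
  then show "fisher_speed M p c t = (let c' = vector_derivative c (at t within {0..1})
      in sqrt (c' \<bullet> (fisher_matrix M p (c t) *v c')))"
    by (simp add: fisher_speed_def)
qed

text \<open>On each closed piece the speed agrees, except possibly at the two ends, with a
  continuous function built from the one-sided extension of the derivative.\<close>

lemma integrable_fisher_speed:
  assumes cont: "\<And>i j. continuous_on \<Theta> (\<lambda>\<theta>. fisher_matrix M p \<theta> $ i $ j)"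
    and c: "piecewise_smooth_curve c" "c ` {0..1} \<subseteq> \<Theta>"
  shows "fisher_speed M p c integrable_on {0..1}"
proof -
  obtain n \<tau> where \<tau>: "\<tau> 0 = 0" "\<tau> n = 1" "\<And>k. k < n \<Longrightarrow> \<tau> k < \<tau> (Suc k)"
    and sm: "\<And>k. k < n \<Longrightarrow> smooth_on_interval (\<tau> k) (\<tau> (Suc k)) c"
    and un: "{0..1} = (\<Union>k<n. {\<tau> k..\<tau> (Suc k)})"
    by (rule piecewise_smooth_curve_partition[OF c(1)]) blast
  have "fisher_speed M p c integrable_on {\<tau> k..\<tau> (Suc k)}" if k: "k < n" for k
  proof -
    let ?I = "{\<tau> k..\<tau> (Suc k)}"
    obtain D where D: "continuous_on ?I c" "continuous_on ?I D"
      and der: "\<And>t. t \<in> {\<tau> k<..<\<tau> (Suc k)} \<Longrightarrow> (c has_vector_derivative D t) (at t)"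
      by (rule smooth_on_interval_derivative[OF sm[OF k]]) blast
    have "c ` ?I \<subseteq> \<Theta>" using c(2) un k by blast
    then have "continuous_on ?I (\<lambda>t. fisher_matrix M p (c t) $ i $ j)" for i j
      by (rule continuous_on_compose2[OF cont D(1)])
    moreover have "continuous_on ?I (\<lambda>t. D t $ i)" for i
      using D(2) by (rule continuous_on_component)
    ultimately have "continuous_on ?I (\<lambda>t. sqrt (D t \<bullet> (fisher_matrix M p (c t) *v D t)))"
      unfolding inner_vec_def matrix_vector_mult_def vec_lambda_beta inner_real_def
      by (intro continuous_on_real_sqrt continuous_on_sum continuous_on_mult) auto
    then have "(\<lambda>t. sqrt (D t \<bullet> (fisher_matrix M p (c t) *v D t))) integrable_on ?I"
      by (rule integrable_continuous_real)
    then show ?thesis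
    proof (rule integrable_spike_finite[of "{\<tau> k, \<tau> (Suc k)}", rotated 2])
      fix t assume "t \<in> ?I - {\<tau> k, \<tau> (Suc k)}"
      then have "vector_derivative c (at t) = D t"
        by (intro vector_derivative_at der) auto
      then show "fisher_speed M p c t = sqrt (D t \<bullet> (fisher_matrix M p (c t) *v D t))"
        by (simp add: fisher_speed_def Let_def)
    qed simp
  qed
  then show ?thesis
    using integrable_on_partition[of n \<tau> "fisher_speed M p c"] \<tau> by simp
qed

text \<open>The velocity is scaled by \<open>r\<close>, and the square root of a quadratic form
  turns this into the factor |r|. Agreement is asked only on a neighbourhood of \<open>t\<close>,
  because a joined path follows each of its curves on one half only.\<close>

lemma fisher_speed_reparametrize:
  assumes c: "(c has_vector_derivative vector_derivative c (at (r * t + s))) (at (r * t + s))"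
    and U: "open U" "t \<in> U" "\<And>u. u \<in> U \<Longrightarrow> g u = c (r * u + s)"
  shows "fisher_speed M p g t = \<bar>r\<bar> * fisher_speed M p c (r * t + s)"
proof -
  have "((\<lambda>t. r * t + s) has_vector_derivative r) (at t)"
    by (auto intro!: derivative_eq_intros simp: has_real_derivative_iff_has_vector_derivative[symmetric])
  from vector_diff_chain_at[OF this, of c] c
  have "((\<lambda>u. c (r * u + s)) has_vector_derivative r *\<^sub>R vector_derivative c (at (r * t + s))) (at t)"
    by (simp add: o_def)
  then have "(g has_vector_derivative r *\<^sub>R vector_derivative c (at (r * t + s))) (at t)"
    by (rule has_vector_derivative_transform_within_open[OF _ U(1,2)]) (use U(3) in auto)
  then have "vector_derivative g (at t) = r *\<^sub>R vector_derivative c (at (r * t + s))"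
    by (rule vector_derivative_at)
  then show ?thesis
    using U(2,3)
    by (simp add: fisher_speed_def Let_def matrix_vector_mult_scaleR real_sqrt_mult
        flip: mult.assoc)
qed

text \<open>Each half of the joined path runs at twice the speed for half the time, so the factors
  cancel. Continuity of the metric supplies the integrability that additivity rests on.\<close>

lemma fisher_length_joinpaths:
  assumes cont: "\<And>i j. continuous_on \<Theta> (\<lambda>\<theta>. fisher_matrix M p \<theta> $ i $ j)"
    and c1: "piecewise_smooth_curve c\<^sub>1" "c\<^sub>1 ` {0..1} \<subseteq> \<Theta>"
    and c2: "piecewise_smooth_curve c\<^sub>2" "c\<^sub>2 ` {0..1} \<subseteq> \<Theta>"
  shows "fisher_length M p (c\<^sub>1 +++ c\<^sub>2) = fisher_length M p c\<^sub>1 + fisher_length M p c\<^sub>2"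
proof -
  let ?v = "fisher_speed M p"
  obtain S1 where S1: "finite S1"
    "\<And>t. t \<in> {0<..<1} - S1 \<Longrightarrow> (c\<^sub>1 has_vector_derivative vector_derivative c\<^sub>1 (at t)) (at t)"
    using piecewise_smooth_curve_derivative[OF c1(1)] by metis
  obtain S2 where S2: "finite S2"
    "\<And>t. t \<in> {0<..<1} - S2 \<Longrightarrow> (c\<^sub>2 has_vector_derivative vector_derivative c\<^sub>2 (at t)) (at t)"
    using piecewise_smooth_curve_derivative[OF c2(1)] by metis
  have I1: "(?v c\<^sub>1 has_integral fisher_length M p c\<^sub>1) (cbox 0 1)"
    using integrable_fisher_speed[OF cont c1] by (simp add: fisher_length_speed integrable_integral)
  have I2: "(?v c\<^sub>2 has_integral fisher_length M p c\<^sub>2) (cbox 0 1)"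
    using integrable_fisher_speed[OF cont c2] by (simp add: fisher_length_speed integrable_integral)
  have "((\<lambda>t. 2 * ?v c\<^sub>1 (2 * t + 0)) has_integral fisher_length M p c\<^sub>1) {0..1/2}"
    using has_integral_mult_right[OF has_integral_affinity'[OF I1, of 2 0], of 2] by simp
  then have J1: "(?v (c\<^sub>1 +++ c\<^sub>2) has_integral fisher_length M p c\<^sub>1) {0..1/2}"
  proof (rule has_integral_spike_finite[of "{0, 1/2} \<union> (\<lambda>t. t / 2) ` S1", rotated 2])
    fix t assume t: "t \<in> {0..1/2} - ({0, 1/2} \<union> (\<lambda>t. t / 2) ` S1)"
    then have "2 * t \<notin> S1" using image_eqI[of t "\<lambda>t. t / 2" "2 * t" S1] by auto
    with t have "2 * t + 0 \<in> {0<..<1} - S1" by auto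
    from fisher_speed_reparametrize[OF S1(2)[OF this], of "{..<1/2}" "c\<^sub>1 +++ c\<^sub>2"]
    show "?v (c\<^sub>1 +++ c\<^sub>2) t = 2 * ?v c\<^sub>1 (2 * t + 0)"
      using t by (auto simp: joinpaths_def)
  qed (use S1 in auto)
  have "((\<lambda>t. 2 * ?v c\<^sub>2 (2 * t + (-1))) has_integral fisher_length M p c\<^sub>2) {1/2..1}"
    using has_integral_mult_right[OF has_integral_affinity'[OF I2, of 2 "-1"], of 2] by simp
  then have J2: "(?v (c\<^sub>1 +++ c\<^sub>2) has_integral fisher_length M p c\<^sub>2) {1/2..1}"
  proof (rule has_integral_spike_finite[of "{1/2, 1} \<union> (\<lambda>t. (t + 1) / 2) ` S2", rotated 2])
    fix t assume t: "t \<in> {1/2..1} - ({1/2, 1} \<union> (\<lambda>t. (t + 1) / 2) ` S2)"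
    then have "2 * t - 1 \<notin> S2" using image_eqI[of t "\<lambda>t. (t + 1) / 2" "2 * t - 1" S2] by auto
    with t have "2 * t + (-1) \<in> {0<..<1} - S2" by auto
    from fisher_speed_reparametrize[OF S2(2)[OF this], of "{1/2<..}" "c\<^sub>1 +++ c\<^sub>2"]
    show "?v (c\<^sub>1 +++ c\<^sub>2) t = 2 * ?v c\<^sub>2 (2 * t + (-1))"
      using t by (auto simp: joinpaths_def)
  qed (use S2 in auto)
  show ?thesis
    using has_integral_combine[OF _ _ J1 J2] by (simp add: fisher_length_speed integral_unique)
qed

text \<open>A diagonal entry integrates a square, and an integral that fails to exist has the value
  0.\<close>

lemma fisher_matrix_diag_nonneg: "0 \<le> fisher_matrix M p \<theta> $ i $ i"
  by (simp add: fisher_matrix_def)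

text \<open>A velocity along one axis sees only a diagonal entry of the metric; this is why the edge
  weights involve \<open>g_ii\<close> alone.\<close>

lemma fisher_quadratic_axis:
  fixes A :: "real ^ 'm ^ 'm::finite"
  shows "(d *\<^sub>R axis i 1) \<bullet> (A *v (d *\<^sub>R axis i 1)) = d\<^sup>2 * A $ i $ i"
  by (simp add: matrix_vector_mult_scaleR inner_axis' matrix_vector_mult_basis column_def power2_eq_square)


section \<open>Coordinate segments\<close>

lemma subst_coord_add: "subst_coord \<theta> i (u + h) = subst_coord \<theta> i u + h *\<^sub>R axis i 1"
  by (simp add: subst_coord_def vec_eq_iff axis_def)

text \<open>Replacing the only coordinate leaves nothing of \<open>v\<close>. This makes the results
  on coordinate segments available in one-parameter models.\<close>

lemma subst_coord_vec1: "subst_coord v 1 u = (vec u :: real ^ 1)"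
  by (simp add: subst_coord_def vec_eq_iff)

lemma continuous_on_subst_coord [continuous_intros]:
  assumes "continuous_on S f"
  shows "continuous_on S (\<lambda>t. subst_coord \<theta> i (f t))"
proof -
  have "continuous_on S (\<lambda>t. if j = i then f t else \<theta> $ j)" for j
    using assms by (cases "j = i") auto
  then show ?thesis
    unfolding subst_coord_def by (rule continuous_on_vec_lambda)
qed

definition coord_segment :: "real ^ 'm::finite \<Rightarrow> 'm \<Rightarrow> real \<Rightarrow> real \<Rightarrow> real \<Rightarrow> real ^ 'm" where
  "coord_segment \<theta> i x y t = subst_coord \<theta> i (x + t * (y - x))"

lemma coord_segment_affine:
  "coord_segment \<theta> i x y = (\<lambda>t. subst_coord \<theta> i x + t *\<^sub>R ((y - x) *\<^sub>R axis i 1))"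
  by (simp add: coord_segment_def subst_coord_add fun_eq_iff)

lemma image_affine_Icc01: "(\<lambda>t. x + t * (y - x)) ` {0..1} = closed_segment x (y::real)"
  by (auto simp: closed_segment_def image_def algebra_simps)

lemma piecewise_smooth_coord_segment: "piecewise_smooth_curve (coord_segment \<theta> i x y)"
  unfolding coord_segment_affine
  by (intro piecewise_smooth_curve_if_smooth smooth_on_interval_affine_curve)

lemma coord_segment_image:
  "coord_segment \<theta> i x y ` {0..1} = subst_coord \<theta> i ` closed_segment x y"
  unfolding image_affine_Icc01[symmetric] by (auto simp: coord_segment_def image_image)

text \<open>The velocity is the constant \<open>d\<close> times an axis vector, so the speed is the
  absolute value of \<open>d * h\<close>, while the signed product integrates to the oriented
  integral by substitution.\<close>

lemma fisher_length_coord_segment: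
  assumes cont: "continuous_on (closed_segment x y) (\<lambda>u. fisher_matrix M p (subst_coord \<theta> i u) $ i $ i)"
  shows "fisher_length M p (coord_segment \<theta> i x y)
    = \<bar>LBINT u=x..y. sqrt (fisher_matrix M p (subst_coord \<theta> i u) $ i $ i)\<bar>"
proof -
  define h where "h u = sqrt (fisher_matrix M p (subst_coord \<theta> i u) $ i $ i)" for u
  define d where "d = y - x"
  have h0: "h u \<ge> 0" for u
    by (simp add: h_def fisher_matrix_diag_nonneg)
  have "((\<lambda>t. d * h (x + t * d)) has_integral (LBINT u=x + 0 * d..x + 1 * d. h u)) {0..1}"
  proof (rule has_integral_substitution_piecewise[where S = "{}" and f = "\<lambda>t. x + t * d"])
    show "continuous_on ((\<lambda>t. x + t * d) ` {0..1}) h"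
      using continuous_on_real_sqrt[OF cont] unfolding d_def image_affine_Icc01 h_def .
    show "((\<lambda>t. x + t * d) has_vector_derivative d) (at t)" for t
      by (auto intro!: derivative_eq_intros simp: has_real_derivative_iff_has_vector_derivative[symmetric])
  qed (auto intro!: continuous_intros)
  then have I: "((\<lambda>t. d * h (x + t * d)) has_integral (LBINT u=x..y. h u)) {0..1}"
    by (simp add: d_def)
  have "(coord_segment \<theta> i x y has_vector_derivative d *\<^sub>R axis i 1) (at t)" for t
    unfolding coord_segment_affine d_def by (auto intro!: derivative_eq_intros)
  then have vd: "vector_derivative (coord_segment \<theta> i x y) (at t) = d *\<^sub>R axis i 1" for t
    by (rule vector_derivative_at)
  then have speed: "fisher_speed M p (coord_segment \<theta> i x y) t = \<bar>d * h (x + t * d)\<bar>" for t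
    unfolding fisher_speed_def Let_def vd fisher_quadratic_axis
    by (simp add: real_sqrt_mult abs_mult h0 coord_segment_def d_def[symmetric] flip: h_def)
  have "((\<lambda>t. \<bar>d * h (x + t * d)\<bar>) has_integral \<bar>LBINT u=x..y. h u\<bar>) {0..1}"
  \<comment> \<open>Since \<open>h\<close> is non-negative, the sign of \<open>d * h\<close> is that
    of \<open>d\<close> throughout, so the absolute value passes through the integral.\<close>
  proof (cases "d \<ge> 0")
    case True
    then have pos: "0 \<le> d * h (x + t * d)" for t using h0 by simp
    have "(LBINT u=x..y. h u) \<ge> 0"
      using I by (rule has_integral_nonneg) (use pos in auto)
    then show ?thesis using I pos by simp
  next
    case False
    then have neg: "d * h (x + t * d) \<le> 0" for t using h0 by (simp add: mult_nonpos_nonneg)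
    have J: "((\<lambda>t. - (d * h (x + t * d))) has_integral - (LBINT u=x..y. h u)) {0..1}"
      using I by (rule has_integral_neg)
    then have "- (LBINT u=x..y. h u) \<ge> 0"
      by (rule has_integral_nonneg) (use neg in auto)
    then show ?thesis using J neg by (simp add: abs_of_nonpos)
  qed
  then show ?thesis
    unfolding fisher_length_speed speed[abs_def] h_def by (rule integral_unique)
qed


section \<open>One-parameter models and submodels\<close>

text \<open>The hypothesis \<open>seg\<close> makes the straight segment an admissible curve, which
  gives the upper bound. The lower bound treats all curves in \<open>\<Theta>\<close>, including
  those that overshoot or turn back.\<close>

lemma fisher_rao_dist_one_parameter:
  fixes \<Theta> :: "(real ^ 1) set"
  assumes cont: "continuous_on \<Theta> (\<lambda>\<theta>. fisher_matrix M p \<theta> $ 1 $ 1)"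
    and seg: "vec ` closed_segment x y \<subseteq> \<Theta>"
  shows "fisher_rao_dist M \<Theta> p (vec x) (vec y)
    = ereal \<bar>LBINT u=x..y. sqrt (fisher_matrix M p (vec u) $ 1 $ 1)\<bar>"
proof (rule antisym)
  define h where "h u = sqrt (fisher_matrix M p (vec u) $ 1 $ 1)" for u
  have h0: "h u \<ge> 0" for u
    by (simp add: h_def fisher_matrix_diag_nonneg)
  \<comment> \<open>The set \<open>T\<close> is arbitrary because a competing curve may leave the
    segment between \<open>x\<close> and \<open>y\<close>. Writing \<open>vec u\<close> as a
    coordinate substitution into an arbitrary point yields its continuity in
    \<open>u\<close>.\<close>
  have conth: "continuous_on T h" if "vec ` T \<subseteq> \<Theta>" for T
    unfolding h_def using that
    by (intro continuous_on_real_sqrt continuous_on_compose2[OF cont])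
      (auto simp: subst_coord_vec1[of undefined, symmetric] intro!: continuous_intros)
  let ?c = "coord_segment 0 1 x y :: real \<Rightarrow> real ^ 1"
  have "continuous_on (closed_segment x y) (\<lambda>u. fisher_matrix M p (subst_coord 0 1 u) $ 1 $ 1)"
    by (intro continuous_on_compose2[OF cont] continuous_intros) (use seg subst_coord_vec1 in auto)
  then have "fisher_length M p ?c = \<bar>LBINT u=x..y. h u\<bar>"
    by (simp add: fisher_length_coord_segment subst_coord_vec1 h_def)
  moreover have "?c ` {0..1} \<subseteq> \<Theta>"
    using seg by (simp add: coord_segment_image subst_coord_vec1)
  moreover have "?c 0 = vec x" "?c 1 = vec y"
    by (simp_all add: coord_segment_def subst_coord_vec1)
  ultimately show "fisher_rao_dist M \<Theta> p (vec x) (vec y) \<le> ereal \<bar>LBINT u=x..y. h u\<bar>"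
    unfolding fisher_rao_dist_def
    by (intro INF_lower2[of ?c]) (auto intro: piecewise_smooth_coord_segment)
  show "ereal \<bar>LBINT u=x..y. h u\<bar> \<le> fisher_rao_dist M \<Theta> p (vec x) (vec y)"
    unfolding fisher_rao_dist_def
  proof (rule INF_greatest, clarify)
    fix c assume c: "piecewise_smooth_curve c" "c ` {0..1} \<subseteq> \<Theta>" "c 0 = vec x" "c 1 = vec y"
    let ?f = "\<lambda>t. c t $ 1" and ?d = "\<lambda>t. vector_derivative c (at t) $ 1"
    have vec_f: "vec (?f t) = c t" for t
      by (simp add: vec_eq_iff)
    obtain S where S: "finite S" "continuous_on {0..1} c"
      "\<And>t. t \<in> {0<..<1} - S \<Longrightarrow> (c has_vector_derivative vector_derivative c (at t)) (at t)"
      by (rule piecewise_smooth_curve_derivative[OF c(1)]) blast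
    \<comment> \<open>The integrand is the speed with a sign; its integral depends only on the end
      points of \<open>c\<close>.\<close>
    have "((\<lambda>t. ?d t * h (?f t)) has_integral (LBINT u=?f 0..?f 1. h u)) {0..1}"
    proof (rule has_integral_substitution_piecewise[OF S(1)])
      show "continuous_on {0..1} ?f"
        using S(2) by (rule continuous_on_component)
      show "(?f has_vector_derivative ?d t) (at t)" if "t \<in> {0<..<1} - S" for t
        by (rule bounded_linear.has_vector_derivative[OF bounded_linear_vec_nth S(3)[OF that]])
      show "continuous_on (?f ` {0..1}) h"
        by (rule conth) (use c(2) vec_f in auto)
    qed
    then have I: "((\<lambda>t. ?d t * h (?f t)) has_integral (LBINT u=x..y. h u)) {0..1}"
      using c by simp
    have speed: "fisher_speed M p c t = \<bar>?d t * h (?f t)\<bar>" for t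
    proof -
      have "vector_derivative c (at t) = ?d t *\<^sub>R axis 1 1"
        by (simp add: vec_eq_iff axis_def)
      then have "fisher_speed M p c t = sqrt ((?d t)\<^sup>2 * fisher_matrix M p (c t) $ 1 $ 1)"
        unfolding fisher_speed_def Let_def by (metis fisher_quadratic_axis)
      then show ?thesis
        by (simp add: real_sqrt_mult abs_mult h0 h_def vec_f fisher_matrix_diag_nonneg)
    qed
    have "norm (integral {0..1} (\<lambda>t. ?d t * h (?f t))) \<le> integral {0..1} (fisher_speed M p c)"
    proof (rule Henstock_Kurzweil_Integration.integral_norm_bound_integral)
      \<comment> \<open>All indices of type \<open>1\<close> coincide, so continuity of the one
        entry covers the whole matrix.\<close>
      have "continuous_on \<Theta> (\<lambda>\<theta>. fisher_matrix M p \<theta> $ i $ j)" for i j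
        using cont num1_eq1[of i] num1_eq1[of j] by (simp only:)
      then show "fisher_speed M p c integrable_on {0..1}"
        using c(1,2) by (rule integrable_fisher_speed)
    qed (use I speed in auto)
    then show "ereal \<bar>LBINT u=x..y. h u\<bar> \<le> ereal (fisher_length M p c)"
      using I by (simp add: integral_unique fisher_length_speed)
  qed
qed

text \<open>A shift by \<open>h\<close> in the submodel is a shift by \<open>h\<close> along axis
  \<open>i\<close> in the full model, so the scores agree, and both models assign the same measure
  to the point.\<close>

lemma fisher_matrix_submodel:
  "fisher_matrix M (submodel p \<theta> i) v $ 1 $ 1 = fisher_matrix M p (subst_coord \<theta> i (v $ 1)) $ i $ i"
proof -
  have "score (submodel p \<theta> i) 1 v x = score p i (subst_coord \<theta> i (v $ 1)) x" for x
    by (simp add: score_def partial_def submodel_def subst_coord_add axis_def)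
  moreover have "model_measure M (submodel p \<theta> i) v = model_measure M p (subst_coord \<theta> i (v $ 1))"
    by (simp add: model_measure_def submodel_def)
  ultimately show ?thesis by (simp add: fisher_matrix_def)
qed

lemma fisher_rao_dist_submodel:
  assumes cont: "continuous_on \<Theta> (\<lambda>\<theta>. fisher_matrix M p \<theta> $ i $ i)"
    and seg: "subst_coord \<theta> i ` closed_segment x y \<subseteq> \<Theta>"
  shows "fisher_rao_dist M (submodel_params \<Theta> \<theta> i) (submodel p \<theta> i) (vec x) (vec y)
    = ereal \<bar>LBINT u=x..y. sqrt (fisher_matrix M p (subst_coord \<theta> i u) $ i $ i)\<bar>"
proof -
  have "continuous_on (submodel_params \<Theta> \<theta> i) (\<lambda>v. fisher_matrix M p (subst_coord \<theta> i (v $ 1)) $ i $ i)"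
    by (intro continuous_on_compose2[OF cont] continuous_intros) (auto simp: submodel_params_def)
  then show ?thesis
    using fisher_rao_dist_one_parameter[of "submodel_params \<Theta> \<theta> i" M "submodel p \<theta> i" x y] seg
    by (simp add: fisher_matrix_submodel submodel_params_def image_subset_iff)
qed


section \<open>Walks in the hypercube\<close>

lemma hypercube_edge:
  assumes "(a, b) \<in> parcs hypercube"
  defines "i \<equiv> edge_index (a, b)"
  shows "a i \<noteq> b i" "\<And>j. j \<noteq> i \<Longrightarrow> a j = b j"
proof -
  have ex: "\<exists>!i. a i \<noteq> b i" using assms(1) by (simp add: hypercube_def)
  show "a i \<noteq> b i"
    using theI'[OF ex] by (simp add: i_def edge_index_def)
  then show "a j = b j" if "j \<noteq> i" for j
    using ex that by blast
qed

lemma cube_vertex_edge: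
  assumes "(a, b) \<in> parcs hypercube"
  defines "i \<equiv> edge_index (a, b)"
  shows "cube_vertex \<theta>\<^sub>0 \<theta>\<^sub>1 b = subst_coord (cube_vertex \<theta>\<^sub>0 \<theta>\<^sub>1 a) i (cube_vertex \<theta>\<^sub>0 \<theta>\<^sub>1 b $ i)"
  using hypercube_edge[OF assms(1)] by (auto simp: i_def vec_eq_iff subst_coord_def cube_vertex_def)

lemma subst_coord_self [simp]: "subst_coord \<theta> i (\<theta> $ i) = \<theta>"
  by (simp add: subst_coord_def vec_eq_iff)

text \<open>The map \<open>subst_coord \<theta> i\<close> is affine in its last argument. This
  translates between edges as segments in parameter space and intervals of a single
  coordinate.\<close>

lemma subst_coord_closed_segment:
  "subst_coord \<theta> i ` closed_segment x y = closed_segment (subst_coord \<theta> i x) (subst_coord \<theta> i y)"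
proof -
  have "subst_coord \<theta> i ((1 - t) * x + t * y)
      = (1 - t) *\<^sub>R subst_coord \<theta> i x + t *\<^sub>R subst_coord \<theta> i y" for t
    by (auto simp: vec_eq_iff subst_coord_def algebra_simps)
  then show ?thesis
    by (simp add: closed_segment_image_interval image_image)
qed

text \<open>The weight always integrates from \<open>\<theta>\<^sub>0\<close> to
  \<open>\<theta>\<^sub>1\<close>, whichever way the arc points. An arc that switches its coordinate
  from 1 back to 0 reverses the orientation, and the absolute value absorbs the sign.\<close>

lemma edge_weight_endpoints:
  assumes "(a, b) \<in> parcs hypercube"
  defines "i \<equiv> edge_index (a, b)"
  shows "edge_weight M p \<theta>\<^sub>0 \<theta>\<^sub>1 (a, b) =
    \<bar>LBINT u=cube_vertex \<theta>\<^sub>0 \<theta>\<^sub>1 a $ i..cube_vertex \<theta>\<^sub>0 \<theta>\<^sub>1 b $ i.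
       sqrt (fisher_matrix M p (subst_coord (cube_vertex \<theta>\<^sub>0 \<theta>\<^sub>1 a) i u) $ i $ i)\<bar>"
proof (cases "a i")
  case True
  then have "\<not> b i" using hypercube_edge(1)[OF assms(1)] by (simp add: i_def)
  with True show ?thesis
    unfolding edge_weight_def Let_def i_def[symmetric] fst_conv
    by (subst interval_integral_endpoints_reverse) (simp add: cube_vertex_def)
next
  case False
  then have "b i" using hypercube_edge(1)[OF assms(1)] by (simp add: i_def)
  with False show ?thesis
    unfolding edge_weight_def Let_def i_def[symmetric] fst_conv
    by (simp add: cube_vertex_def)
qed

text \<open>Induction on the walk, prepending the coordinate segment of its first arc to the curve
  of the rest. Repeated vertices are allowed, as the infimum defining \<open>\<mu>\<close> ranges
  over all walks.\<close>

lemma hypercube_walk_curve: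
  fixes \<theta>\<^sub>0 \<theta>\<^sub>1 :: "real ^ 'm::finite"
  assumes cont: "\<And>i j. continuous_on \<Theta> (\<lambda>\<theta>. fisher_matrix M p \<theta> $ i $ j)"
    and vertices_in: "\<And>a. cube_vertex \<theta>\<^sub>0 \<theta>\<^sub>1 a \<in> \<Theta>"
    and edges_in: "\<And>a b. (a, b) \<in> parcs hypercube \<Longrightarrow>
        closed_segment (cube_vertex \<theta>\<^sub>0 \<theta>\<^sub>1 a) (cube_vertex \<theta>\<^sub>0 \<theta>\<^sub>1 b) \<subseteq> \<Theta>"
    and walk: "pre_digraph.awalk (with_proj hypercube) a es b"
  shows "\<exists>c. piecewise_smooth_curve c \<and> c ` {0..1} \<subseteq> \<Theta> \<and>
    c 0 = cube_vertex \<theta>\<^sub>0 \<theta>\<^sub>1 a \<and> c 1 = cube_vertex \<theta>\<^sub>0 \<theta>\<^sub>1 b \<and>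
    fisher_length M p c = wf_digraph.awalk_cost (edge_weight M p \<theta>\<^sub>0 \<theta>\<^sub>1) es"
proof -
  interpret pair_graph "hypercube :: ('m \<Rightarrow> bool) pair_pre_digraph"
    by (rule pair_graph_hypercube)
  let ?w = "edge_weight M p \<theta>\<^sub>0 \<theta>\<^sub>1" and ?v = "cube_vertex \<theta>\<^sub>0 \<theta>\<^sub>1"
  show ?thesis using walk
  proof (induction es arbitrary: a)
    case Nil
    then have [simp]: "a = b" by (simp add: awalk_Nil_iff)
    \<comment> \<open>The empty walk still requires a curve on [0, 1]: a degenerate segment in an
      arbitrary direction is constant, and its length is an integral from a point to itself.\<close>
    obtain i :: 'm where True by simp
    define c where "c = coord_segment (?v a) i (?v a $ i) (?v a $ i)"
    have c: "c t = ?v a" for t by (simp add: c_def coord_segment_def)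
    have "fisher_length M p c = awalk_cost ?w []"
      unfolding c_def by (subst fisher_length_coord_segment) auto
    then show ?case
      using vertices_in[of a] c piecewise_smooth_coord_segment[of "?v a" i "?v a $ i" "?v a $ i"]
      unfolding c_def[symmetric] by (intro exI[of _ c] conjI) (assumption | simp add: image_subset_iff)+
  next
    case (Cons e es)
    obtain a' where e: "e = (a, a')" "(a, a') \<in> parcs hypercube" and w: "awalk a' es b"
      using Cons.prems by (cases e) (auto simp: awalk_Cons_iff)
    from Cons.IH[OF w] obtain c\<^sub>2 where c2: "piecewise_smooth_curve c\<^sub>2" "c\<^sub>2 ` {0..1} \<subseteq> \<Theta>"
      "c\<^sub>2 0 = ?v a'" "c\<^sub>2 1 = ?v b" "fisher_length M p c\<^sub>2 = awalk_cost ?w es"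
      by blast
    define i where "i = edge_index (a, a')"
    define c\<^sub>1 where "c\<^sub>1 = coord_segment (?v a) i (?v a $ i) (?v a' $ i)"
    have va': "subst_coord (?v a) i (?v a' $ i) = ?v a'"
      using cube_vertex_edge[OF e(2)] by (simp add: i_def)
    have seg: "subst_coord (?v a) i ` closed_segment (?v a $ i) (?v a' $ i) \<subseteq> \<Theta>"
      using edges_in[OF e(2)] by (simp add: subst_coord_closed_segment va')
    have "fisher_length M p c\<^sub>1 = ?w e"
      unfolding c\<^sub>1_def e(1) edge_weight_endpoints[OF e(2)] i_def[symmetric]
      by (intro fisher_length_coord_segment continuous_on_compose2[OF cont] continuous_intros seg)
    moreover have c1: "piecewise_smooth_curve c\<^sub>1" "c\<^sub>1 ` {0..1} \<subseteq> \<Theta>" "c\<^sub>1 0 = ?v a" "c\<^sub>1 1 = ?v a'"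
      using seg va' unfolding c\<^sub>1_def
      by (auto simp: piecewise_smooth_coord_segment coord_segment_image) (simp_all add: coord_segment_def)
    moreover have "(c\<^sub>1 +++ c\<^sub>2) ` {0..1} \<subseteq> \<Theta>"
      using c1(2) c2(2) path_image_join_subset[of c\<^sub>1 c\<^sub>2] unfolding path_image_def by blast
    ultimately show ?case
      using c2 piecewise_smooth_curve_joinpaths[of c\<^sub>1 c\<^sub>2] fisher_length_joinpaths[OF cont c1(1,2) c2(1,2)]
      by (intro exI[of _ "c\<^sub>1 +++ c\<^sub>2"]) (auto simp: joinpaths_def)
  qed
qed

text \<open>The first conjunct confirms that the integral used as edge weight is the Fisher-Rao
  distance in the uniparametric submodel; the second is the bound. Regularity controls the metric
  only on \<open>\<Theta>\<close>, so \<open>edges_in\<close> spells out what the weights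
  presuppose.\<close>

theorem mainTheorem4:
  fixes M :: "'x measure"
    and \<Theta> :: "(real ^ 'm::finite) set"
    and p :: "real ^ 'm \<Rightarrow> 'x \<Rightarrow> real"
    and \<theta>\<^sub>0 \<theta>\<^sub>1 :: "real ^ 'm"
  assumes regular: "regular_model M \<Theta> p"
    and params: "\<theta>\<^sub>0 \<in> \<Theta>" "\<theta>\<^sub>1 \<in> \<Theta>"
    and edges_in: "\<And>a b. (a, b) \<in> parcs hypercube \<Longrightarrow>
        closed_segment (cube_vertex \<theta>\<^sub>0 \<theta>\<^sub>1 a) (cube_vertex \<theta>\<^sub>0 \<theta>\<^sub>1 b) \<subseteq> \<Theta>"
  shows "(\<forall>(a, b) \<in> parcs hypercube.
            let i = edge_index (a, b);
                \<theta>a = cube_vertex \<theta>\<^sub>0 \<theta>\<^sub>1 a;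
                \<theta>b = cube_vertex \<theta>\<^sub>0 \<theta>\<^sub>1 b
            in fisher_rao_dist M (submodel_params \<Theta> \<theta>a i) (submodel p \<theta>a i)
                 (vec (\<theta>a $ i)) (vec (\<theta>b $ i))
               = ereal (edge_weight M p \<theta>\<^sub>0 \<theta>\<^sub>1 (a, b)))
         \<and> fisher_rao_dist M \<Theta> p \<theta>\<^sub>0 \<theta>\<^sub>1 \<le> shortest_path M p \<theta>\<^sub>0 \<theta>\<^sub>1"
proof (intro conjI ballI)
  let ?v = "cube_vertex \<theta>\<^sub>0 \<theta>\<^sub>1"
  have "smooth_on_open \<Theta> (\<lambda>\<theta>. fisher_matrix M p \<theta> $ i $ j)" for i j
    using regular by (simp add: regular_model_def)
  then have cont: "continuous_on \<Theta> (\<lambda>\<theta>. fisher_matrix M p \<theta> $ i $ j)" for i j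
    unfolding smooth_on_open_def by (metis Ck_on.simps(1))
  {
    fix e :: "('m \<Rightarrow> bool) \<times> ('m \<Rightarrow> bool)" assume "e \<in> parcs hypercube"
    moreover obtain a b where [simp]: "e = (a, b)" by (cases e)
    ultimately have e: "(a, b) \<in> parcs hypercube" by simp
    define i where "i = edge_index (a, b)"
    have "subst_coord (?v a) i ` closed_segment (?v a $ i) (?v b $ i) \<subseteq> \<Theta>"
      using edges_in[OF e] cube_vertex_edge[OF e, of \<theta>\<^sub>0 \<theta>\<^sub>1]
      by (simp add: subst_coord_closed_segment i_def)
    from fisher_rao_dist_submodel[OF cont this] edge_weight_endpoints[OF e, of M p \<theta>\<^sub>0 \<theta>\<^sub>1]
    show "case e of (a, b) \<Rightarrow> let i = edge_index (a, b); \<theta>a = ?v a; \<theta>b = ?v b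
        in fisher_rao_dist M (submodel_params \<Theta> \<theta>a i) (submodel p \<theta>a i)
             (vec (\<theta>a $ i)) (vec (\<theta>b $ i)) = ereal (edge_weight M p \<theta>\<^sub>0 \<theta>\<^sub>1 (a, b))"
      by (simp add: i_def Let_def)
  next
    interpret pair_graph "hypercube :: ('m \<Rightarrow> bool) pair_pre_digraph"
      by (rule pair_graph_hypercube)
    \<comment> \<open>index types are nonempty, so every vertex is an endpoint of an edge\<close>
    have vertices_in: "?v a \<in> \<Theta>" for a
    proof -
      obtain i :: 'm where True by simp
      have "(a, a(i := \<not> a i)) \<in> parcs hypercube"
        by (auto simp: hypercube_def split: if_splits)
      from edges_in[OF this] show ?thesis by auto
    qed
    have ends: "?v (\<lambda>_. False) = \<theta>\<^sub>0" "?v (\<lambda>_. True) = \<theta>\<^sub>1"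
      by (simp_all add: cube_vertex_def vec_eq_iff)
    show "fisher_rao_dist M \<Theta> p \<theta>\<^sub>0 \<theta>\<^sub>1 \<le> shortest_path M p \<theta>\<^sub>0 \<theta>\<^sub>1"
      unfolding shortest_path_def \<mu>_def
    \<comment> \<open>It suffices to bound the distance by the cost of every single walk, and the
      curve traced by the walk is a competitor of exactly that length.\<close>
    proof (rule INF_greatest, clarify)
      fix es assume "awalk (\<lambda>_. False) es (\<lambda>_. True)"
      from hypercube_walk_curve[OF cont vertices_in edges_in this] obtain c where
        "piecewise_smooth_curve c" "c ` {0..1} \<subseteq> \<Theta>" "c 0 = \<theta>\<^sub>0" "c 1 = \<theta>\<^sub>1"
        "fisher_length M p c = awalk_cost (edge_weight M p \<theta>\<^sub>0 \<theta>\<^sub>1) es"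
        unfolding ends by blast
      then show "fisher_rao_dist M \<Theta> p \<theta>\<^sub>0 \<theta>\<^sub>1 \<le> ereal (awalk_cost (edge_weight M p \<theta>\<^sub>0 \<theta>\<^sub>1) es)"
        unfolding fisher_rao_dist_def by (intro INF_lower2[of c]) auto
    qed
  }
qed

end
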